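(* Let $G=(N,E,w)$ be a weighted graph. If for all $\emptyset\neq S\subseteq N$ the $\tilde{\mathcal{P}}_{\min}$-restricted game of the unanimity game $(N,u_S)$ is convex, then the Reinforced Cycle condition is satisfied by $G$.
   Context: $G=(N,E,w)$ is a finite simple undirected graph with vertex set $N$, edge set $E$ and weight function $w:E\to\mathbb{R}$; $w_k$ denotes $w(e_k)$. A game is a pair $(N,v)$ with $v:2^N\to\mathbb{R}$, $v(\emptyset)=0$. It is convex if $v(A\cup B)+v(A\cap B)\ge v(A)+v(B)$ for all $A,B\subseteq N$. The unanimity game is $u_S(A)=1$ if $A\supseteq S$ and $0$ otherwise. For $A\subseteq N$, $E(A)$ is the set of edges with both ends in $A$, $G_A=(A,E(A))$, and $\Sigma(A)$ is the set of minimum weight edges in $E(A)$ (empty if $E(A)=\emptyset$). $\mathcal{P}_{\min}(A)$ is the partition of $A$ into the connected components of $(A,E(A)\setminus\Sigma(A))$. If $A_1,\dots,A_p$ are the connected components of $G_A$, then $\tilde{\mathcal{P}}_{\min}(A)$ is the partition of $A$ whose blocks are all the blocks of $\mathcal{P}_{\min}(A_1),\dots,\mathcal{P}_{\min}(A_p)$. The $\tilde{\mathcal{P}}_{\min}$-restricted game of $(N,v)$ is the game $A\mapsto\sum_{F\in\tilde{\mathcal{P}}_{\min}(A)}v(F)$. Cycles have distinct vertices and are written $C=\{1,e_1,2,e_2,\dots,m,e_m,1\}$ with $e_k=\{k,k+1\}$ for $k<m$ and $e_m=\{m,1\}$; $\hat E(C)$ is $E(C)=\{e_1,\dots,e_m\}$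 together with all chords of $C$ in $G$. Two vertices or edges are "linked by an edge" if some edge of $G$ has one end in the first and the other end in the second (an edge being viewed as the set of its two ends). **Reinforced Cycle condition.** For every cycle $C_m=\{1,e_1,2,\dots,m,e_m,1\}$ with $m\ge4$, labelled so that $w_3=\dots=w_m=\hat M=\max_{e\in\hat E(C_m)}w(e)$: (1) if $w_1<w_3$ (resp. $w_2<w_3$), then any edge of $G$ incident to a vertex $j$ with $4\le j\le m-1$ (resp. $5\le j\le m$) is linked to $e_1$ (resp. $e_2$) by an edge; (2) if $\max(w_1,w_2)<w_3$, then any edge of $G$ incident to a vertex $j$ with $4\le j\le m$ is linked to vertex $2$ by an edge. *)

theory Defs
  imports Complex_Main
begin

definition simple_graph :: "'a set \<Rightarrow> 'a set set \<Rightarrow> bool" where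
  "simple_graph N E \<longleftrightarrow> finite N \<and> (\<forall>e\<in>E. e \<subseteq> N \<and> card e = 2)"

definition convex_game :: "'a set \<Rightarrow> ('a set \<Rightarrow> real) \<Rightarrow> bool" where
  "convex_game N v \<longleftrightarrow> (\<forall>A B. A \<subseteq> N \<longrightarrow> B \<subseteq> N \<longrightarrow> v (A \<union> B) + v (A \<inter> B) \<ge> v A + v B)"

definition unanimity_game :: "'a set \<Rightarrow> 'a set \<Rightarrow> real" where
  "unanimity_game S A = (if S \<subseteq> A then 1 else 0)"

definition induced_edges :: "'a set set \<Rightarrow> 'a set \<Rightarrow> 'a set set" where
  "induced_edges E A = {e \<in> E. e \<subseteq> A}"

definition reachable :: "'a set \<Rightarrow> 'a set set \<Rightarrow> ('a \<times> 'a) set" where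
  "reachable A F = {(x, y). x \<in> A \<and> y \<in> A \<and> (x, y) \<in> {(a, b). {a, b} \<in> F}\<^sup>*}"

text \<open>
  Vertex sets of the connected components of the graph with vertex set \<open>A\<close> and edge set \<open>F\<close>,
  whose edges are assumed to lie inside \<open>A\<close>.  An isolated vertex forms a singleton component.
\<close>
definition components :: "'a set \<Rightarrow> 'a set set \<Rightarrow> 'a set set" where
  "components A F = A // reachable A F"

definition min_edges :: "'a set set \<Rightarrow> ('a set \<Rightarrow> real) \<Rightarrow> 'a set \<Rightarrow> 'a set set" where
  "min_edges E w A = {e \<in> induced_edges E A. \<forall>f \<in> induced_edges E A. w e \<le> w f}"

definition P_min :: "'a set set \<Rightarrow> ('a set \<Rightarrow> real) \<Rightarrow> 'a set \<Rightarrow> 'a set set" where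
  "P_min E w A = components A (induced_edges E A - min_edges E w A)"

definition P_min_tilde :: "'a set set \<Rightarrow> ('a set \<Rightarrow> real) \<Rightarrow> 'a set \<Rightarrow> 'a set set" where
  "P_min_tilde E w A = (\<Union>K \<in> components A (induced_edges E A). P_min E w K)"

definition restricted_game :: "('a set \<Rightarrow> 'a set set) \<Rightarrow> ('a set \<Rightarrow> real) \<Rightarrow> 'a set \<Rightarrow> real" where
  "restricted_game P v A = (\<Sum>F \<in> P A. v F)"

text \<open>
  A labelled cycle on \<open>m\<close> vertices is given by a function \<open>c\<close>, of which only the values
  \<open>c 1, \<dots>, c m\<close> matter; its \<open>k\<close>-th edge joins \<open>c k\<close> to the cyclically next vertex.  In a
  simple graph the vertices of a cycle are automatically vertices of the graph.
\<close>
definition cycle_edge :: "nat \<Rightarrow> (nat \<Rightarrow> 'a) \<Rightarrow> nat \<Rightarrow> 'a set" where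
  "cycle_edge m c k = {c k, c (if k = m then 1 else k + 1)}"

definition cycle_edges :: "nat \<Rightarrow> (nat \<Rightarrow> 'a) \<Rightarrow> 'a set set" where
  "cycle_edges m c = cycle_edge m c ` {1..m}"

definition is_cycle :: "'a set set \<Rightarrow> nat \<Rightarrow> (nat \<Rightarrow> 'a) \<Rightarrow> bool" where
  "is_cycle E m c \<longleftrightarrow> 3 \<le> m \<and> inj_on c {1..m} \<and> cycle_edges m c \<subseteq> E"

definition chords :: "'a set set \<Rightarrow> nat \<Rightarrow> (nat \<Rightarrow> 'a) \<Rightarrow> 'a set set" where
  "chords E m c = {e \<in> E. e \<subseteq> c ` {1..m} \<and> e \<notin> cycle_edges m c}"

definition cycle_edges_hat :: "'a set set \<Rightarrow> nat \<Rightarrow> (nat \<Rightarrow> 'a) \<Rightarrow> 'a set set" where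
  "cycle_edges_hat E m c = cycle_edges m c \<union> chords E m c"

text \<open>
  Vertices and edges are both passed as vertex sets, a vertex \<open>x\<close> as \<open>{x}\<close>.  The sets \<open>X\<close> and
  \<open>Y\<close> may overlap, and the linking edge may be \<open>X\<close> or \<open>Y\<close> itself.
\<close>
definition linked :: "'a set set \<Rightarrow> 'a set \<Rightarrow> 'a set \<Rightarrow> bool" where
  "linked E X Y \<longleftrightarrow> (\<exists>x\<in>X. \<exists>y\<in>Y. {x, y} \<in> E)"

text \<open>
  The condition is imposed on every labelling of every cycle for which the edges
  \<open>e\<^sub>3, \<dots>, e\<^sub>m\<close> all have the maximum weight over the cycle edges and chords.
\<close>
definition reinforced_cycle_condition :: "'a set set \<Rightarrow> ('a set \<Rightarrow> real) \<Rightarrow> bool" where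
  "reinforced_cycle_condition E w \<longleftrightarrow>
    (\<forall>m c. is_cycle E m c \<longrightarrow> 4 \<le> m \<longrightarrow>
      (\<forall>k\<in>{3..m}. w (cycle_edge m c k) = Max (w ` cycle_edges_hat E m c)) \<longrightarrow>
      (w (cycle_edge m c 1) < w (cycle_edge m c 3) \<longrightarrow>
        (\<forall>j\<in>{4..m - 1}. \<forall>f\<in>E. c j \<in> f \<longrightarrow> linked E f (cycle_edge m c 1))) \<and>
      (w (cycle_edge m c 2) < w (cycle_edge m c 3) \<longrightarrow>
        (\<forall>j\<in>{5..m}. \<forall>f\<in>E. c j \<in> f \<longrightarrow> linked E f (cycle_edge m c 2))) \<and>
      (max (w (cycle_edge m c 1)) (w (cycle_edge m c 2)) < w (cycle_edge m c 3) \<longrightarrow>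
        (\<forall>j\<in>{4..m}. \<forall>f\<in>E. c j \<in> f \<longrightarrow> linked E f {c 2})))"

end

theory Submission
  imports Defs
begin

text \<open>
  For \<open>S = {p, q}\<close> the restricted game is the indicator of \<open>p\<close> and \<open>q\<close> being joined by edges that
  are not of minimum weight in their component.  So, by convexity, if an edge \<open>{p, q}\<close> has a
  strictly lighter edge in its component both of \<open>G\<^sub>A\<close> and of \<open>G\<^sub>B\<close>, then it cannot be isolated in
  the graph induced on \<open>A \<inter> B\<close>.  Given an edge \<open>f\<close> at \<open>c j\<close>, this is applied to the two arcs of
  the cycle from \<open>c j\<close> to \<open>e\<^sub>1\<close> or \<open>e\<^sub>2\<close>, enlarged by the other end of \<open>f\<close>, when \<open>f\<close> is not too
  light; when \<open>f\<close> is light, it is applied to a single arc and to the union of \<open>f\<close> with the first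
  edge of that arc.
\<close>

section \<open>Blocks of the partition\<close>

text \<open>Unlike in \<open>reachable\<close>, end points need not lie in \<open>A\<close>, so
  paths compose without membership conditions.\<close>

definition edge_path :: "'a set set \<Rightarrow> 'a set \<Rightarrow> ('a \<times> 'a) set" where
  "edge_path E A = {(a, b). {a, b} \<in> induced_edges E A}\<^sup>*"

lemma adjacency_rtrancl_sym:
  "(x, y) \<in> {(a, b). {a, b} \<in> F}\<^sup>* \<Longrightarrow> (y, x) \<in> {(a, b). {a, b} \<in> F}\<^sup>*"
  by (rule symD[OF sym_rtrancl]) (auto simp: sym_def insert_commute)

lemma edge_path_sym: "(x, y) \<in> edge_path E A \<Longrightarrow> (y, x) \<in> edge_path E A"
  unfolding edge_path_def by (rule adjacency_rtrancl_sym)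

lemma edge_path_trans:
  "(x, y) \<in> edge_path E A \<Longrightarrow> (y, z) \<in> edge_path E A \<Longrightarrow> (x, z) \<in> edge_path E A"
  unfolding edge_path_def by (rule rtrancl_trans)

lemma edge_path_edge:
  "{x, y} \<in> E \<Longrightarrow> x \<in> A \<Longrightarrow> y \<in> A \<Longrightarrow> (x, y) \<in> edge_path E A"
  unfolding edge_path_def induced_edges_def by auto

lemma equiv_reachable: "equiv A (reachable A F)"
proof (rule equivI)
  show "sym (reachable A F)"
    unfolding reachable_def by (auto intro!: symI dest: adjacency_rtrancl_sym)
  show "trans (reachable A F)"
    unfolding reachable_def by (auto intro!: transI elim: rtrancl_trans)
qed (auto simp: reachable_def refl_on_def)

lemma components_subset: "K \<in> components A F \<Longrightarrow> K \<subseteq> A"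
  unfolding components_def by (rule in_quotient_imp_subset[OF equiv_reachable])

lemma components_reachable:
  "K \<in> components A F \<Longrightarrow> x \<in> K \<Longrightarrow> y \<in> K \<Longrightarrow> (x, y) \<in> reachable A F"
  unfolding components_def by (rule in_quotient_imp_in_rel[OF equiv_reachable]) auto

lemma components_eq:
  "K \<in> components A F \<Longrightarrow> L \<in> components A F \<Longrightarrow> x \<in> K \<Longrightarrow> x \<in> L \<Longrightarrow> K = L"
  using quotient_disj[OF equiv_reachable] unfolding components_def by blast

lemma component_of: "x \<in> A \<Longrightarrow> reachable A F `` {x} \<in> components A F"
  unfolding components_def by (rule quotientI)

lemma P_min_tilde_subset: "F \<in> P_min_tilde E w A \<Longrightarrow> F \<subseteq> A"
  unfolding P_min_tilde_def P_min_def by (blast dest: components_subset)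

text \<open>A common point first identifies the components of the induced graph, then the blocks
  inside that component.\<close>

lemma P_min_tilde_eq:
  assumes "F \<in> P_min_tilde E w A" "F' \<in> P_min_tilde E w A" "x \<in> F" "x \<in> F'"
  shows "F = F'"
proof -
  obtain K K' where K: "K \<in> components A (induced_edges E A)" "F \<in> P_min E w K"
    and K': "K' \<in> components A (induced_edges E A)" "F' \<in> P_min E w K'"
    using assms unfolding P_min_tilde_def by blast
  have "x \<in> K" "x \<in> K'"
    using K K' assms components_subset unfolding P_min_def by blast+
  then have "K = K'" using K K' components_eq by metis
  then show ?thesis using K K' assms components_eq unfolding P_min_def by metis
qed

text \<open>Blocks are disjoint, so the point \<open>p\<close> of \<open>S\<close> lies in at most
  one of them and the sum has at most one nonzero term.\<close>

lemma restricted_unanimity_game: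
  assumes "finite A" "p \<in> S"
  shows "restricted_game (P_min_tilde E w) (unanimity_game S) A =
    (if \<exists>F \<in> P_min_tilde E w A. S \<subseteq> F then 1 else 0)"
proof -
  have fin: "finite (P_min_tilde E w A)"
    by (rule finite_subset[of _ "Pow A"]) (use assms in \<open>auto dest: P_min_tilde_subset\<close>)
  show ?thesis
  proof (cases "\<exists>F \<in> P_min_tilde E w A. S \<subseteq> F")
    case True
    then obtain F where F: "F \<in> P_min_tilde E w A" "S \<subseteq> F" by blast
    have "unanimity_game S F' = (if F' = F then 1 else 0)" if "F' \<in> P_min_tilde E w A" for F'
      using P_min_tilde_eq[OF that F(1)] F assms(2) unfolding unanimity_game_def by auto
    then have "restricted_game (P_min_tilde E w) (unanimity_game S) A =
        (\<Sum>F' \<in> P_min_tilde E w A. if F' = F then 1 else 0)"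
      unfolding restricted_game_def by (intro sum.cong) auto
    then show ?thesis using True fin F by simp
  next
    case False
    then show ?thesis unfolding restricted_game_def unanimity_game_def
      by (auto intro!: sum.neutral)
  qed
qed

section \<open>The consequence of convexity\<close>

text \<open>For an edge \<open>{p, q}\<close> inside \<open>A\<close> this is failure of minimality
  in its component. The edge itself joins \<open>q\<close> to \<open>p\<close>, so a path from
  \<open>p\<close> suffices.\<close>

definition has_lighter_edge ::
    "'a set set \<Rightarrow> ('a set \<Rightarrow> real) \<Rightarrow> 'a set \<Rightarrow> 'a \<Rightarrow> 'a \<Rightarrow> bool" where
  "has_lighter_edge E w A p q \<longleftrightarrow>
    (\<exists>r s. {r, s} \<in> E \<and> r \<in> A \<and> s \<in> A \<and> (p, r) \<in> edge_path E A \<and> w {r, s} < w {p, q})"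

lemma has_lighter_edgeI:
  "{r, s} \<in> E \<Longrightarrow> r \<in> A \<Longrightarrow> s \<in> A \<Longrightarrow> (p, r) \<in> edge_path E A \<Longrightarrow> w {r, s} < w {p, q}
    \<Longrightarrow> has_lighter_edge E w A p q"
  unfolding has_lighter_edge_def by blast

text \<open>The component \<open>K\<close> of \<open>p\<close> contains both edges, so
  \<open>{p, q}\<close> survives the deletion of \<open>min_edges E w K\<close> and keeps its ends
  connected.\<close>

lemma has_lighter_edge_imp_block:
  assumes "{p, q} \<in> E" "p \<in> A" "q \<in> A" "has_lighter_edge E w A p q"
  shows "\<exists>F \<in> P_min_tilde E w A. {p, q} \<subseteq> F"
proof -
  obtain r s where rs: "{r, s} \<in> E" "r \<in> A" "s \<in> A" "(p, r) \<in> edge_path E A"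
      "w {r, s} < w {p, q}"
    using assms unfolding has_lighter_edge_def by blast
  define K where "K = reachable A (induced_edges E A) `` {p}"
  have K: "K \<in> components A (induced_edges E A)"
    unfolding K_def using assms by (intro component_of)
  have in_K: "y \<in> K" if "y \<in> A" "(p, y) \<in> edge_path E A" for y
    using that assms unfolding K_def reachable_def edge_path_def by auto
  have pq: "p \<in> K" "q \<in> K"
    using in_K assms edge_path_edge[of p q E A] by (auto simp: edge_path_def)
  have "r \<in> K" "s \<in> K"
    using in_K rs edge_path_trans[OF rs(4) edge_path_edge[OF rs(1-3)]] by auto
  then have "{p, q} \<in> induced_edges E K - min_edges E w K"
    using assms pq rs unfolding induced_edges_def min_edges_def by force
  then have "(p, q) \<in> reachable K (induced_edges E K - min_edges E w K)"
    using pq unfolding reachable_def by auto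
  then have "{p, q} \<subseteq> reachable K (induced_edges E K - min_edges E w K) `` {p}"
    using pq unfolding reachable_def by auto
  moreover have "reachable K (induced_edges E K - min_edges E w K) `` {p} \<in> P_min_tilde E w A"
    using component_of[OF pq(1)] K unfolding P_min_tilde_def P_min_def by blast
  ultimately show ?thesis by blast
qed

text \<open>A block containing \<open>p\<close> and \<open>q\<close> would lie in a component with
  no further vertex. The only possible edge there is of minimum weight and gets deleted, which
  separates \<open>p\<close> from \<open>q\<close>.\<close>

lemma isolated_edge_imp_no_block:
  assumes "simple_graph N E" "p \<noteq> q"
    and isolated: "\<And>y z. y \<in> {p, q} \<Longrightarrow> z \<in> A - {p, q} \<Longrightarrow> {y, z} \<notin> E"
    and F: "F \<in> P_min_tilde E w A"
  shows "\<not> {p, q} \<subseteq> F"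
proof
  assume pq: "{p, q} \<subseteq> F"
  obtain K where K: "K \<in> components A (induced_edges E A)" "F \<in> P_min E w K"
    using F unfolding P_min_tilde_def by blast
  then have "F \<subseteq> K" using components_subset unfolding P_min_def by blast
  have "K \<subseteq> {p, q}"
  proof
    fix y assume "y \<in> K"
    then have "(p, y) \<in> {(a, b). {a, b} \<in> induced_edges E A}\<^sup>*"
      using components_reachable[OF K(1)] pq \<open>F \<subseteq> K\<close> unfolding reachable_def by auto
    then show "y \<in> {p, q}"
    proof (induction rule: rtrancl_induct)
      case (step y z)
      then have "{y, z} \<in> E" "z \<in> A" unfolding induced_edges_def by auto
      with isolated step.IH show ?case by blast
    qed simp
  qed
  \<comment> \<open>Edges have two elements, so an edge inside a pair is that pair.\<close>
  have only: "e = {p, q}" if "e \<in> induced_edges E K" for e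
  proof (rule card_subset_eq)
    have "e \<in> E" "e \<subseteq> K" using that unfolding induced_edges_def by auto
    then show "e \<subseteq> {p, q}" "card e = card {p, q}"
      using \<open>K \<subseteq> {p, q}\<close> assms unfolding simple_graph_def by auto
  qed simp
  then have "induced_edges E K - min_edges E w K = {}"
    unfolding min_edges_def by (auto dest: only)
  then have "(p, q) \<in> reachable K {}"
    using components_reachable K(2) pq unfolding P_min_def by (metis insert_subset)
  then show False using \<open>p \<noteq> q\<close> unfolding reachable_def by simp
qed

text \<open>Otherwise the game of \<open>{p, q}\<close> is 1 at \<open>A\<close> and at
  \<open>B\<close>, 0 at \<open>A \<inter> B\<close> and at most 1 at \<open>A \<union> B\<close>,
  against convexity.\<close>

lemma convex_imp_crossing_edge:
  assumes simple: "simple_graph N E"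
    and convex: "\<And>S. S \<noteq> {} \<Longrightarrow> S \<subseteq> N \<Longrightarrow>
      convex_game N (restricted_game (P_min_tilde E w) (unanimity_game S))"
    and AB: "A \<subseteq> N" "B \<subseteq> N"
    and pq: "{p, q} \<in> E" "p \<in> A \<inter> B" "q \<in> A \<inter> B"
    and lighter: "has_lighter_edge E w A p q" "has_lighter_edge E w B p q"
  shows "\<exists>y \<in> {p, q}. \<exists>z \<in> A \<inter> B - {p, q}. {y, z} \<in> E"
proof (rule ccontr)
  assume "\<not> ?thesis"
  then have isolated: "\<And>y z. y \<in> {p, q} \<Longrightarrow> z \<in> A \<inter> B - {p, q} \<Longrightarrow> {y, z} \<notin> E" by blast
  have "card {p, q} = 2" using simple pq unfolding simple_graph_def by auto
  then have "p \<noteq> q" by auto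
  let ?v = "restricted_game (P_min_tilde E w) (unanimity_game {p, q})"
  have fin: "finite A" "finite B"
    using simple AB finite_subset unfolding simple_graph_def by auto
  have v: "?v X = (if \<exists>F \<in> P_min_tilde E w X. {p, q} \<subseteq> F then 1 else 0)" if "finite X" for X
    using restricted_unanimity_game[OF that, of p "{p, q}"] by simp
  have "\<exists>F \<in> P_min_tilde E w A. {p, q} \<subseteq> F" "\<exists>F \<in> P_min_tilde E w B. {p, q} \<subseteq> F"
    using has_lighter_edge_imp_block[OF pq(1)] pq(2,3) lighter by blast+
  then have "?v A = 1" "?v B = 1"
    by (simp_all only: v fin if_True)
  moreover have "?v (A \<inter> B) = 0"
  proof -
    have "\<not> {p, q} \<subseteq> F" if "F \<in> P_min_tilde E w (A \<inter> B)" for F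
      using isolated that by (rule isolated_edge_imp_no_block[OF simple \<open>p \<noteq> q\<close>])
    then have "\<not> (\<exists>F \<in> P_min_tilde E w (A \<inter> B). {p, q} \<subseteq> F)" by blast
    then show ?thesis by (simp only: v fin finite_Int if_False simp_thms)
  qed
  moreover have "?v (A \<union> B) \<le> 1"
    unfolding v[OF finite_UnI[OF fin]] by simp
  moreover have "?v A + ?v B \<le> ?v (A \<union> B) + ?v (A \<inter> B)"
  proof -
    have "{p, q} \<subseteq> N" using AB pq by blast
    then have "convex_game N ?v" by (intro convex) simp_all
    then show ?thesis using AB unfolding convex_game_def by simp
  qed
  ultimately show False by linarith
qed

section \<open>Cycles with a constant-weight path\<close>

text \<open>A locale lets the results on \<open>e\<^sub>1\<close> be instantiated again for the
  reflected labelling, where they concern \<open>e\<^sub>2\<close>.\<close>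

locale heavy_path_cycle =
  fixes N :: "'a set" and E :: "'a set set" and w :: "'a set \<Rightarrow> real"
    and m :: nat and c :: "nat \<Rightarrow> 'a" and M :: real
  assumes simple: "simple_graph N E"
    and convex: "\<And>S. S \<noteq> {} \<Longrightarrow> S \<subseteq> N \<Longrightarrow>
      convex_game N (restricted_game (P_min_tilde E w) (unanimity_game S))"
    and cycle: "is_cycle E m c"
    and m_ge: "4 \<le> m"
    and heavy: "\<And>k. k \<in> {3..m} \<Longrightarrow> w (cycle_edge m c k) = M"
begin

lemmas crossing_edge = convex_imp_crossing_edge[OF simple convex]

lemma cycle_edge_in: "k \<in> {1..m} \<Longrightarrow> cycle_edge m c k \<in> E"
  using cycle unfolding is_cycle_def cycle_edges_def by blast

lemma edge_in: "1 \<le> k \<Longrightarrow> k < m \<Longrightarrow> {c k, c (k + 1)} \<in> E"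
  using cycle_edge_in[of k] unfolding cycle_edge_def by simp

lemma last_edge_in: "{c m, c 1} \<in> E"
  using cycle_edge_in[of m] m_ge unfolding cycle_edge_def by simp

lemma heavy_edge: "3 \<le> k \<Longrightarrow> k < m \<Longrightarrow> w {c k, c (k + 1)} = M"
  using heavy[of k] unfolding cycle_edge_def by simp

lemma heavy_last_edge: "w {c m, c 1} = M"
  using heavy[of m] m_ge unfolding cycle_edge_def by simp

lemma c_eq_iff: "i \<in> {1..m} \<Longrightarrow> k \<in> {1..m} \<Longrightarrow> c i = c k \<longleftrightarrow> i = k"
  using cycle unfolding is_cycle_def by (auto dest: inj_onD)

lemma edge_subset: "e \<in> E \<Longrightarrow> e \<subseteq> N"
  using simple unfolding simple_graph_def by blast

lemma vertex_in: "i \<in> {1..m} \<Longrightarrow> c i \<in> N"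
  using edge_subset[OF edge_in[of i]] edge_subset[OF last_edge_in] by (cases "i = m") auto

lemma other_end:
  assumes "f \<in> E" "y \<in> f"
  obtains x where "f = {y, x}"
proof -
  have "card f = 2" using assms simple unfolding simple_graph_def by blast
  then show thesis using assms(2) that by (auto simp: card_2_iff insert_commute)
qed

section \<open>Paths along the two arcs of the cycle\<close>

lemma arc_path:
  assumes "1 \<le> i" "i \<le> k" "k \<le> m" "c ` {i..k} \<subseteq> A"
  shows "(c i, c k) \<in> edge_path E A"
  using assms(2-)
proof (induction k rule: dec_induct)
  case base
  then show ?case by (simp add: edge_path_def)
next
  case (step k)
  have "(c i, c k) \<in> edge_path E A"
    using step by (intro step.IH) auto
  moreover have "(c k, c (k + 1)) \<in> edge_path E A"
    using step assms(1) by (intro edge_path_edge edge_in) auto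
  ultimately show ?case using edge_path_trans by fastforce
qed

text \<open>This arc reaches \<open>c 1\<close> through the last edge, avoiding the vertices
  strictly between \<open>c 1\<close> and \<open>c j\<close>. Its counterpart is
  \<open>arc_path\<close> reversed.\<close>

lemma forward_path:
  assumes "1 \<le> j" "j \<le> m" "c ` {j..m} \<subseteq> A" "c 1 \<in> A"
  shows "(c j, c 1) \<in> edge_path E A"
proof (rule edge_path_trans)
  show "(c j, c m) \<in> edge_path E A" using assms by (intro arc_path) auto
  show "(c m, c 1) \<in> edge_path E A" using assms by (intro edge_path_edge last_edge_in) auto
qed

section \<open>Edges at a vertex of the heavy path\<close>

text \<open>Otherwise take the arc from \<open>c j\<close> to \<open>e\<^sub>1\<close> that avoids
  \<open>x\<close>. Its first edge has weight \<open>M\<close>, so \<open>e\<^sub>1\<close> is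
  lighter on the arc and \<open>{c j, x}\<close> is lighter on the three vertices of
  \<open>?B\<close>, yet that edge is isolated in the intersection.\<close>

lemma light_edge_meets_first:
  assumes j: "4 \<le> j" "j \<le> m"
    and f: "{c j, x} \<in> E" "w {c j, x} < M"
    and w1: "w {c 1, c 2} < M"
  shows "x \<in> {c 1, c 2}"
proof (rule ccontr)
  assume x: "x \<notin> {c 1, c 2}"
  have xN: "x \<in> N" using edge_subset[OF f(1)] by simp
  have e1: "{c 1, c 2} \<in> E" using edge_in[of 1] m_ge by (simp add: numeral_2_eq_2)
  show False
  proof (cases "x \<in> c ` {j..m}")
    case False
    \<comment> \<open>\<open>?n\<close> is the cyclic successor of \<open>j\<close>. Since
      \<open>x\<close> is outside \<open>?A\<close>, the sets share only \<open>c j\<close> and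
      \<open>c ?n\<close>.\<close>
    let ?n = "if j = m then 1 else j + 1"
    let ?A = "{c 1, c 2} \<union> c ` {j..m}" and ?B = "{c j, c ?n, x}"
    have n: "{c j, c ?n} \<in> E" "w {c j, c ?n} = M"
      using j edge_in[of j] last_edge_in heavy_edge[of j] heavy_last_edge by auto
    have nA: "c ?n \<in> ?A" using j by auto
    have "\<exists>y \<in> {c j, c ?n}. \<exists>z \<in> ?A \<inter> ?B - {c j, c ?n}. {y, z} \<in> E"
    proof (rule crossing_edge)
      show "has_lighter_edge E w ?A (c j) (c ?n)"
        using j n w1 e1 by (intro has_lighter_edgeI[of "c 1" "c 2"] forward_path) auto
      show "has_lighter_edge E w ?B (c j) (c ?n)"
        using n f by (intro has_lighter_edgeI[of "c j" x]) (auto simp: edge_path_def)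
    qed (use j n nA m_ge vertex_in xN in \<open>auto split: if_splits\<close>)
    then show False using x False by auto
  next
    case True
    then obtain k where k: "x = c k" "k \<in> {j..m}" by blast
    have "k \<noteq> j"
      using simple f(1) k(1) unfolding simple_graph_def by auto
    \<comment> \<open>Here \<open>x\<close> lies on the ascending arc, so the descending one is
      used; \<open>j - 1 \<ge> 3\<close> gives its first edge weight \<open>M\<close>.\<close>
    let ?A = "c ` {1..j}" and ?B = "{c j, c (j - 1), x}"
    have n: "{c j, c (j - 1)} \<in> E" "w {c j, c (j - 1)} = M"
      using j edge_in[of "j - 1"] heavy_edge[of "j - 1"] by (auto simp: insert_commute)
    have xA: "x \<notin> ?A"
    proof
      assume "x \<in> ?A"
      then obtain i where "x = c i" "i \<in> {1..j}" by blast
      then show False using c_eq_iff[of i k] k j \<open>k \<noteq> j\<close> by auto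
    qed
    have "\<exists>y \<in> {c j, c (j - 1)}. \<exists>z \<in> ?A \<inter> ?B - {c j, c (j - 1)}. {y, z} \<in> E"
    proof (rule crossing_edge)
      show "has_lighter_edge E w ?A (c j) (c (j - 1))"
        using j n w1 e1
        by (intro has_lighter_edgeI[of "c 1" "c 2"] edge_path_sym[OF arc_path]) auto
      show "has_lighter_edge E w ?B (c j) (c (j - 1))"
        using n f by (intro has_lighter_edgeI[of "c j" x]) (auto simp: edge_path_def)
    qed (use j n vertex_in edge_subset[OF n(1)] xN in auto)
    then show False using xA by auto
  qed
qed

text \<open>A light \<open>f\<close> ends in \<open>e\<^sub>1\<close>. Otherwise both arcs, enlarged
  by \<open>x\<close>, contain the lighter \<open>e\<^sub>1\<close>, and outside \<open>f\<close>
  they can share only its ends.\<close>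

lemma linked_first_edge:
  assumes j: "4 \<le> j" "j \<le> m - 1"
    and f: "f \<in> E" "c j \<in> f"
    and w1: "w {c 1, c 2} < M"
  shows "linked E f {c 1, c 2}"
proof -
  obtain x where x: "f = {c j, x}" using other_end f by metis
  have xN: "x \<in> N" using edge_subset f x by auto
  have e1: "{c 1, c 2} \<in> E" using edge_in[of 1] m_ge by (simp add: numeral_2_eq_2)
  show ?thesis
  proof (cases "w f < M")
    case True
    then have "x \<in> {c 1, c 2}" using light_edge_meets_first[of j x] j f x w1 by simp
    then show ?thesis using f x unfolding linked_def by blast
  next
    case False
    let ?A = "{c 1, c 2, x} \<union> c ` {j..m}" and ?B = "insert x (c ` {1..j})"
    have "\<exists>y \<in> {c j, x}. \<exists>z \<in> ?A \<inter> ?B - {c j, x}. {y, z} \<in> E"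
    proof (rule crossing_edge)
      show "has_lighter_edge E w ?A (c j) x"
        using j x False w1 e1 by (intro has_lighter_edgeI[of "c 1" "c 2"] forward_path) auto
      show "has_lighter_edge E w ?B (c j) x"
        using j x False w1 e1
        by (intro has_lighter_edgeI[of "c 1" "c 2"] edge_path_sym[OF arc_path]) auto
    qed (use j f x vertex_in xN in auto)
    moreover have "?A \<inter> ?B - {c j, x} \<subseteq> {c 1, c 2}"
      using j by (auto simp: c_eq_iff)
    ultimately show ?thesis unfolding linked_def x by blast
  qed
qed

text \<open>The descending arc now stops at \<open>c 2\<close> with \<open>e\<^sub>2\<close> as its
  lighter edge. Dropping \<open>c 1\<close> leaves \<open>c 2\<close> as the only possible common
  vertex outside \<open>f\<close>.\<close>

lemma linked_second_vertex:
  assumes j: "4 \<le> j" "j \<le> m"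
    and f: "f \<in> E" "c j \<in> f"
    and w12: "w {c 1, c 2} < M" "w {c 2, c 3} < M"
  shows "linked E f {c 2}"
proof -
  obtain x where x: "f = {c j, x}" using other_end f by metis
  have xN: "x \<in> N" using edge_subset f x by auto
  have e1: "{c 1, c 2} \<in> E" using edge_in[of 1] m_ge by (simp add: numeral_2_eq_2)
  have e2: "{c 2, c 3} \<in> E" using edge_in[of 2] m_ge by simp
  show ?thesis
  proof (cases "w f < M")
    case True
    then have "x \<in> {c 1, c 2}" using light_edge_meets_first[of j x] j f x w12 by simp
    \<comment> \<open>If \<open>x = c 2\<close>, the edge \<open>f\<close> itself links; if
      \<open>x = c 1\<close>, the edge \<open>e\<^sub>1\<close> does.\<close>
    then show ?thesis using f x e1 unfolding linked_def by blast
  next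
    case False
    let ?A = "{c 1, c 2, x} \<union> c ` {j..m}" and ?B = "insert x (c ` {2..j})"
    have "\<exists>y \<in> {c j, x}. \<exists>z \<in> ?A \<inter> ?B - {c j, x}. {y, z} \<in> E"
    proof (rule crossing_edge)
      show "has_lighter_edge E w ?A (c j) x"
        using j x False w12 e1 by (intro has_lighter_edgeI[of "c 1" "c 2"] forward_path) auto
      show "has_lighter_edge E w ?B (c j) x"
        using j x False w12 e2
        by (intro has_lighter_edgeI[of "c 2" "c 3"] edge_path_sym[OF arc_path]) auto
    qed (use j f x vertex_in xN in auto)
    moreover have "?A \<inter> ?B - {c j, x} \<subseteq> {c 2}"
      using j by (auto simp: c_eq_iff)
    ultimately show ?thesis unfolding linked_def x by blast
  qed
qed

text \<open>The reflection fixing vertex \<open>2\<close> exchanges \<open>e\<^sub>1\<close> and \<open>e\<^sub>2\<close> and permutes the other edges.\<close>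

lemma reflected:
  defines "\<rho> \<equiv> \<lambda>k. if k \<le> 3 then 4 - k else m + 4 - k"
  shows "heavy_path_cycle N E w m (c \<circ> \<rho>) M"
proof
  \<comment> \<open>An edge is indexed by the vertex it leaves, and reflection reverses direction;
    hence the constants are one less than in \<open>\<rho>\<close>.\<close>
  have edge: "cycle_edge m (c \<circ> \<rho>) k =
      cycle_edge m c (if k \<le> 2 then 3 - k else m + 3 - k)" if "k \<in> {1..m}" for k
  proof -
    have "1 \<le> k" "k \<le> m" using that by simp_all
    \<comment> \<open>The cases isolate the indices where \<open>\<rho>\<close> changes formula or
      an edge wraps around.\<close>
    then consider "k = 1" | "k = 2" | "k = 3" | "4 \<le> k" "k < m" | "4 \<le> k" "k = m"
      by linarith
    moreover have "Suc (m + 3 - k) = m + 4 - k" using \<open>k \<le> m\<close> by simp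
    ultimately show ?thesis
      using m_ge
      by cases (auto simp: cycle_edge_def \<rho>_def insert_commute add.commute[of 3 m] numeral_eq_Suc)
  qed
  have "inj_on \<rho> {1..m}" "\<rho> ` {1..m} \<subseteq> {1..m}"
    unfolding inj_on_def \<rho>_def using m_ge by auto
  then have "inj_on (c \<circ> \<rho>) {1..m}"
    using cycle unfolding is_cycle_def by (blast intro: comp_inj_on inj_on_subset)
  moreover have "cycle_edge m (c \<circ> \<rho>) k \<in> E" if "k \<in> {1..m}" for k
    unfolding edge[OF that] using that m_ge by (intro cycle_edge_in) auto
  ultimately show "is_cycle E m (c \<circ> \<rho>)"
    using cycle unfolding is_cycle_def cycle_edges_def by blast
  show "w (cycle_edge m (c \<circ> \<rho>) k) = M" if "k \<in> {3..m}" for k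
  proof -
    have "m + 3 - k \<in> {3..m}" using that by auto
    then have "w (cycle_edge m c (m + 3 - k)) = M" by (rule heavy)
    then show ?thesis using that edge[of k] by auto
  qed
qed (use simple convex m_ge in auto)

text \<open>In the reflected labelling \<open>e\<^sub>2\<close> comes first and \<open>c j\<close>
  has index \<open>m + 4 - j\<close>, which ranges over \<open>{4..m - 1}\<close> for
  \<open>j\<close> in \<open>{5..m}\<close>.\<close>

lemma linked_second_edge:
  assumes j: "5 \<le> j" "j \<le> m"
    and f: "f \<in> E" "c j \<in> f"
    and w2: "w {c 2, c 3} < M"
  shows "linked E f {c 2, c 3}"
  using heavy_path_cycle.linked_first_edge[OF reflected, of "m + 4 - j" f] assms m_ge
  by (auto simp: insert_commute)

end

theorem proposition9:
  fixes N :: "'a set" and E :: "'a set set" and w :: "'a set \<Rightarrow> real"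
  assumes "simple_graph N E"
    and "\<And>S. S \<noteq> {} \<Longrightarrow> S \<subseteq> N \<Longrightarrow>
      convex_game N (restricted_game (P_min_tilde E w) (unanimity_game S))"
  shows "reinforced_cycle_condition E w"
  unfolding reinforced_cycle_condition_def
proof (intro allI impI)
  fix m c
  assume cycle: "is_cycle E m c" "4 \<le> m"
    and max: "\<forall>k\<in>{3..m}. w (cycle_edge m c k) = Max (w ` cycle_edges_hat E m c)"
  interpret heavy_path_cycle N E w m c "Max (w ` cycle_edges_hat E m c)"
    using assms cycle max by unfold_locales auto
  have e: "cycle_edge m c 1 = {c 1, c 2}" "cycle_edge m c 2 = {c 2, c 3}"
    using m_ge by (simp_all add: cycle_edge_def numeral_2_eq_2 numeral_3_eq_3)
  have w3: "w (cycle_edge m c 3) = Max (w ` cycle_edges_hat E m c)"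
    using heavy[of 3] m_ge by simp
  show "(w (cycle_edge m c 1) < w (cycle_edge m c 3) \<longrightarrow>
        (\<forall>j\<in>{4..m - 1}. \<forall>f\<in>E. c j \<in> f \<longrightarrow> linked E f (cycle_edge m c 1))) \<and>
      (w (cycle_edge m c 2) < w (cycle_edge m c 3) \<longrightarrow>
        (\<forall>j\<in>{5..m}. \<forall>f\<in>E. c j \<in> f \<longrightarrow> linked E f (cycle_edge m c 2))) \<and>
      (max (w (cycle_edge m c 1)) (w (cycle_edge m c 2)) < w (cycle_edge m c 3) \<longrightarrow>
        (\<forall>j\<in>{4..m}. \<forall>f\<in>E. c j \<in> f \<longrightarrow> linked E f {c 2}))"
    unfolding w3 e
    using linked_first_edge linked_second_edge linked_second_vertex by auto
qed

end
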